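(* Let $d\ge 1$ and $k\ge 2$ be integers and let $G$ be a $K_{1,d}$-free graph with a strong bramble $\mathcal{B}$ of $\alpha$-order at least $dk$. Then there exists an induced cycle $C$ of length at least $k$ in $G$ such that $N[C]\cap B\ne\emptyset$ for all $B\in\mathcal{B}$.
   Context: All graphs are finite, simple, and undirected. $K_{1,d}$ is the star with $d$ leaves; $G$ is $K_{1,d}$-free if it does not contain $K_{1,d}$ as an induced subgraph. For $X\subseteq V(G)$, $\alpha(X)$ denotes the maximum size of an independent set in $G[X]$; $X$ is connected if $G[X]$ is connected. $N[C]$ denotes the closed neighbourhood of $V(C)$ in $G$, i.e. $V(C)$ together with all vertices having a neighbour in $V(C)$. A strong bramble in $G$ is a collection $\mathcal{B}=\{B_1,\dots,B_n\}$ of connected sets $B_i\subseteq V(G)$ such that $B_i\cap B_j\ne\emptyset$ for all $i,j\in\{1,\dots,n\}$. A cover for $\mathcal{B}$ is a set $X\subseteq V(G)$ with $B_i\cap X\ne\emptyset$ for all $i$. The $\alpha$-order of $\mathcal{B}$ is $\min\{\alpha(X): X\subseteq V(G)\text{ is a cover for }\mathcal{B}\}$. *)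

theory Defs
  imports "Graph_Theory.Graph_Theory"
begin

text \<open>
  A finite, simple, undirected graph is an instance of the locale \<^locale>\<open>graph\<close>: a finite
  loop-free symmetric digraph without parallel arcs.  An undirected edge is a pair of opposite
  arcs, \<open>G \<restriction> X\<close> is the induced subgraph \<open>G[X]\<close>, and \<^const>\<open>connected\<close> excludes the null graph.
\<close>

definition star_free :: "nat \<Rightarrow> ('a, 'b) pre_digraph \<Rightarrow> bool" where
  "star_free d G \<equiv> \<not> (\<exists>H. induced_subgraph H G \<and> K\<^bsub>1,d\<^esub> H)"

definition independent_set :: "('a, 'b) pre_digraph \<Rightarrow> 'a set \<Rightarrow> bool" where
  "independent_set G S \<equiv> S \<subseteq> verts G \<and> (\<forall>u\<in>S. \<forall>v\<in>S. \<not> u \<rightarrow>\<^bsub>G\<^esub> v)"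

definition independence_number :: "('a, 'b) pre_digraph \<Rightarrow> nat" where
  "independence_number G \<equiv> Max (card ` {S. independent_set G S})"

definition alpha :: "('a, 'b) pre_digraph \<Rightarrow> 'a set \<Rightarrow> nat" where
  "alpha G X \<equiv> independence_number (G \<restriction> X)"

definition closed_neighbourhood :: "('a, 'b) pre_digraph \<Rightarrow> 'a set \<Rightarrow> 'a set" where
  "closed_neighbourhood G X \<equiv> X \<union> {v \<in> verts G. \<exists>u\<in>X. v \<rightarrow>\<^bsub>G\<^esub> u}"

text \<open>
  The case \<open>A = B\<close> is deliberately included in the intersection condition.
\<close>

definition strong_bramble :: "('a, 'b) pre_digraph \<Rightarrow> 'a set set \<Rightarrow> bool" where
  "strong_bramble G \<B> \<equiv>
     (\<forall>B\<in>\<B>. B \<subseteq> verts G \<and> connected (G \<restriction> B)) \<and> (\<forall>A\<in>\<B>. \<forall>B\<in>\<B>. A \<inter> B \<noteq> {})"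

definition bramble_cover :: "('a, 'b) pre_digraph \<Rightarrow> 'a set set \<Rightarrow> 'a set \<Rightarrow> bool" where
  "bramble_cover G \<B> X \<equiv> X \<subseteq> verts G \<and> (\<forall>B\<in>\<B>. B \<inter> X \<noteq> {})"

text \<open>
  For a strong bramble in a finite graph the minimum ranges over a finite nonempty set, since
  \<open>verts G\<close> is itself a cover.
\<close>

definition alpha_order :: "('a, 'b) pre_digraph \<Rightarrow> 'a set set \<Rightarrow> nat" where
  "alpha_order G \<B> \<equiv> Min (alpha G ` {X. bramble_cover G \<B> X})"

text \<open>
  The cycle graph on \<open>n \<ge> 3\<close> vertices.  The library's \<^const>\<open>pre_digraph.cycle\<close> is not used because
  it is a closed walk of a digraph, so that in a symmetric digraph every edge gives a cycle of
  length 2.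
\<close>

definition cycle_graph :: "nat \<Rightarrow> ('a, 'b) pre_digraph \<Rightarrow> bool" where
  "cycle_graph n C \<equiv> graph C \<and> 3 \<le> n \<and>
     (\<exists>v. bij_betw v {..<n} (verts C) \<and>
          arcs_ends C = {(v i, v j) | i j. i < n \<and> j < n \<and> (j = Suc i mod n \<or> i = Suc j mod n)})"

end

theory Submission
  imports Defs
begin

text \<open>
  Call an induced path \<open>p\<close> covering if its closed neighbourhood \<open>N[p]\<close> meets every element of the
  bramble.  A covering path exists by an argument in the style of Gyarfas
  (\<open>ex_covering_induced_path\<close>): as long as some element avoids \<open>N[p]\<close>, the path can be prolonged
  towards it.

  Let \<open>p\<close> be a shortest covering path, with ends \<open>x\<close> and \<open>y\<close>.  Removing \<open>x\<close> destroys the covering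
  property, so some element \<open>B1\<close> is met by \<open>N[x]\<close> but by no \<open>N[z]\<close> with \<open>z\<close> another vertex of \<open>p\<close>;
  likewise some \<open>B2\<close> is met by \<open>N[y]\<close> alone.  Since \<open>B1\<close> and \<open>B2\<close> are connected and
  intersect, an induced path leads from \<open>y\<close> back to \<open>x\<close> with all its inner vertices in
  \<open>B1 \<union> B2\<close>.  These inner vertices have no neighbours on \<open>p\<close> besides \<open>x\<close> and \<open>y\<close>, so \<open>p\<close> and the
  return path together form an induced cycle as soon as \<open>p\<close> has at least three vertices
  (\<open>induced_cycle_of_minimal_covering_path\<close>).  The cycle contains \<open>p\<close>, hence its closed
  neighbourhood meets every element of the bramble.

  It remains to see that \<open>p\<close> is long.  In a graph without induced \<open>K\<^sub>1\<^sub>,\<^sub>d\<close> an independent set has at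
  most \<open>max 1 (d - 1)\<close> vertices in the closed neighbourhood of one vertex, so
  \<open>\<alpha>(N[p]) \<le> |p| max 1 (d - 1)\<close>, while \<open>N[p]\<close> is a cover and therefore \<open>\<alpha>(N[p]) \<ge> d k\<close>.
\<close>

section \<open>Adjacency, neighbourhoods and induced subgraphs\<close>

lemma arcs_ends_induce_subgraph: "arcs_ends (G \<restriction> X) = arcs_ends G \<inter> X \<times> X"
  by (auto simp: arcs_ends_conv)

lemma closed_neighbourhood_Un:
  "closed_neighbourhood G (X \<union> Y) = closed_neighbourhood G X \<union> closed_neighbourhood G Y"
  by (auto simp: closed_neighbourhood_def)

lemma closed_neighbourhood_mono:
  "X \<subseteq> Y \<Longrightarrow> closed_neighbourhood G X \<subseteq> closed_neighbourhood G Y"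
  by (auto simp: closed_neighbourhood_def)

context graph
begin

lemma adj_sym: "u \<rightarrow>\<^bsub>G\<^esub> v \<longleftrightarrow> v \<rightarrow>\<^bsub>G\<^esub> u"
  using graph_symmetric by blast

lemma graph_induce_subgraph:
  assumes "X \<subseteq> verts G"
  shows "graph (G \<restriction> X)"
proof -
  have ind: "induced_subgraph (G \<restriction> X) G"
    using assms by auto
  interpret H: digraph "G \<restriction> X"
    using ind by (rule digraphI_induced)
  show ?thesis
    using ind sym_arcs by (intro H.graphI) (rule induced_graph_imp_symmetric)
qed

lemma connected_induce_subgraphD:
  assumes "connected (G \<restriction> X)" "u \<in> X" "v \<in> X"
  shows "(u, v) \<in> rtrancl_on X (arcs_ends G)"
proof -
  have "(u, v) \<in> rtrancl_on X (parcs (mk_symmetric (G \<restriction> X)))"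
    using assms by (simp add: connected_def strongly_connected_def reachable_def)
  moreover have "parcs (mk_symmetric (G \<restriction> X)) \<subseteq> arcs_ends G"
    using graph_symmetric by (auto simp: parcs_mk_symmetric arcs_ends_conv)
  ultimately show ?thesis
    using rtrancl_on_mono[of _ "arcs_ends G" X X] by blast
qed

section \<open>Independent sets in neighbourhoods\<close>

lemma card_independent_neighbours_less:
  assumes "star_free d G" and v: "v \<in> verts G" and S: "independent_set G S"
    and adj: "\<And>u. u \<in> S \<Longrightarrow> v \<rightarrow>\<^bsub>G\<^esub> u"
  shows "card S < d"
proof (rule ccontr)
  assume "\<not> card S < d"
  then obtain T where T: "T \<subseteq> S" "card T = d"
    by (meson not_less obtain_subset_with_card_n)
  have X: "insert v T \<subseteq> verts G" and "v \<notin> T"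
    using v S T adj adj_not_same by (auto simp: independent_set_def)
  have "\<not> v \<rightarrow>\<^bsub>G\<^esub> v" and "\<And>u. u \<in> T \<Longrightarrow> v \<rightarrow>\<^bsub>G\<^esub> u \<and> u \<rightarrow>\<^bsub>G\<^esub> v"
    and "\<And>u w. u \<in> T \<Longrightarrow> w \<in> T \<Longrightarrow> \<not> u \<rightarrow>\<^bsub>G\<^esub> w"
    using T(1) S adj adj_not_same graph_symmetric unfolding independent_set_def by blast+
  then have "arcs_ends (G \<restriction> insert v T) = {v} \<times> T \<union> T \<times> {v}"
    by (auto simp: arcs_ends_induce_subgraph)
  then have "verts (G \<restriction> insert v T) = {v} \<union> T \<and> {v} \<inter> T = {} \<and> card {v} = 1 \<and> card T = d
      \<and> arcs_ends (G \<restriction> insert v T) = {v} \<times> T \<union> T \<times> {v}"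
    using T(2) \<open>v \<notin> T\<close> by simp
  then have "K\<^bsub>1,d\<^esub> (G \<restriction> insert v T)"
    using graph_induce_subgraph[OF X] unfolding complete_bipartite_digraph_def by blast
  then show False
    using assms(1) induced_induce[OF X] by (auto simp: star_free_def)
qed

text \<open>
  The maximum is needed because an independent set that contains \<open>v\<close> itself has exactly one vertex
  in the closed neighbourhood of \<open>v\<close>, which exceeds \<open>d - 1\<close> when \<open>d = 1\<close>.
\<close>
lemma card_independent_closed_neighbourhood_le:
  assumes "star_free d G" and v: "v \<in> verts G" and S: "independent_set G S"
  shows "card (S \<inter> closed_neighbourhood G {v}) \<le> max 1 (d - 1)"
proof (cases "v \<in> S")
  case True
  then have "S \<inter> closed_neighbourhood G {v} = {v}"
    using S by (auto simp: independent_set_def closed_neighbourhood_def)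
  then show ?thesis
    by simp
next
  case False
  have "card (S \<inter> closed_neighbourhood G {v}) < d"
    using False S
    by (intro card_independent_neighbours_less[OF assms(1) v])
      (auto simp: independent_set_def closed_neighbourhood_def adj_sym)
  then show ?thesis
    by linarith
qed

lemma alpha_closed_neighbourhood_le:
  assumes "star_free d G" and p: "set p \<subseteq> verts G"
  shows "alpha G (closed_neighbourhood G (set p)) \<le> length p * max 1 (d - 1)"
proof -
  let ?N = "closed_neighbourhood G"
  have N: "?N (set p) \<subseteq> verts G"
    using p by (auto simp: closed_neighbourhood_def)
  have bound: "card S \<le> length p * max 1 (d - 1)"
    if ind: "independent_set (G \<restriction> ?N (set p)) S" for S
  proof -
    have sub: "S \<subseteq> ?N (set p)"
      using ind by (simp add: independent_set_def)
    then have S: "independent_set G S"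
      using ind N unfolding independent_set_def arcs_ends_induce_subgraph by blast
    have "?N (set p) = (\<Union>v\<in>set p. ?N {v})"
      unfolding closed_neighbourhood_def by blast
    with sub have "S = (\<Union>v\<in>set p. S \<inter> ?N {v})"
      by blast
    then have "card S \<le> (\<Sum>v\<in>set p. card (S \<inter> ?N {v}))"
      using card_UN_le[of "set p" "\<lambda>v. S \<inter> ?N {v}"] by simp
    also have "\<dots> \<le> card (set p) * max 1 (d - 1)"
      using sum_bounded_above[of "set p" "\<lambda>v. card (S \<inter> ?N {v})" "max 1 (d - 1)"]
        card_independent_closed_neighbourhood_le[OF assms(1) _ S] p by auto
    also have "\<dots> \<le> length p * max 1 (d - 1)"
      using card_length by (rule mult_le_mono1)
    finally show ?thesis .
  qed
  have "finite {S. independent_set (G \<restriction> ?N (set p)) S}"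
    by (rule finite_subset[of _ "Pow (verts G)"]) (use N in \<open>auto simp: independent_set_def\<close>)
  moreover have "independent_set (G \<restriction> ?N (set p)) {}"
    by (simp add: independent_set_def)
  ultimately show ?thesis
    unfolding alpha_def independence_number_def using bound by (intro Max.boundedI) auto
qed


lemma alpha_order_le:
  assumes "bramble_cover G \<B> X"
  shows "alpha_order G \<B> \<le> alpha G X"
proof -
  have "finite {X. bramble_cover G \<B> X}"
    by (rule finite_subset[of _ "Pow (verts G)"]) (auto simp: bramble_cover_def)
  then show ?thesis
    using assms by (auto simp: alpha_order_def intro!: Min_le)
qed

section \<open>Induced paths\<close>

text \<open>
  The recursion prepends vertices, because the covering path below is grown at its head.  In terms
  of positions, it says that two vertices are adjacent exactly if they are consecutive
  (\<open>induced_path_nth\<close>).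
\<close>
fun induced_path :: "'a list \<Rightarrow> bool" where
  "induced_path [] \<longleftrightarrow> True"
| "induced_path (x # p) \<longleftrightarrow>
     x \<in> verts G \<and> x \<notin> set p \<and> (\<forall>y\<in>set p. x \<rightarrow>\<^bsub>G\<^esub> y \<longleftrightarrow> y = hd p) \<and> induced_path p"

lemma induced_path_distinct: "induced_path p \<Longrightarrow> distinct p"
  by (induction p) auto

lemma induced_path_verts: "induced_path p \<Longrightarrow> set p \<subseteq> verts G"
  by (induction p) auto

lemma induced_path_tl: "induced_path p \<Longrightarrow> induced_path (tl p)"
  by (cases p) auto

lemma induced_path_butlast: "induced_path p \<Longrightarrow> induced_path (butlast p)"
proof (induction p)
  case (Cons x p)
  then show ?case
    by (cases p) (auto dest: in_set_butlastD)
qed simp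

lemma induced_path_nth:
  assumes "induced_path p" "i < j" "j < length p"
  shows "p ! i \<rightarrow>\<^bsub>G\<^esub> p ! j \<longleftrightarrow> j = Suc i"
  using assms
proof (induction p arbitrary: i j)
  case (Cons x p)
  obtain j' where j: "j = Suc j'" "j' < length p"
    using Cons.prems by (cases j) auto
  show ?case
  proof (cases i)
    case 0
    have "p ! j' = hd p \<longleftrightarrow> j' = 0"
      using nth_eq_iff_index_eq[OF induced_path_distinct, of p j' 0] Cons.prems j
      by (cases "p = []") (auto simp: hd_conv_nth)
    then show ?thesis
      using Cons.prems j 0 by auto
  next
    case (Suc i')
    then show ?thesis
      using Cons j by auto
  qed
qed simp

text \<open>
  Walking along \<open>p\<close>, jump to the last vertex that equals \<open>x\<close> or is adjacent to it: from there on
  no chord to \<open>x\<close> remains.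
\<close>
lemma induced_path_extend:
  assumes "induced_path p" "x \<in> verts G" "y \<in> set p" "x = y \<or> x \<rightarrow>\<^bsub>G\<^esub> y"
  shows "\<exists>q. induced_path q \<and> q \<noteq> [] \<and> hd q = x \<and> last q = last p \<and> set q \<subseteq> insert x (set p)"
  using assms
proof (induction p arbitrary: y)
  case (Cons z p)
  show ?case
  proof (cases "\<exists>y\<in>set p. x = y \<or> x \<rightarrow>\<^bsub>G\<^esub> y")
    case True
    then have "\<exists>q. induced_path q \<and> q \<noteq> [] \<and> hd q = x \<and> last q = last p \<and> set q \<subseteq> insert x (set p)"
      using Cons by auto
    then show ?thesis
      using True by auto
  next
    case False
    show ?thesis
    proof (cases "x = z")
      case True
      then show ?thesis
        using Cons.prems by (intro exI[of _ "z # p"]) auto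
    next
      case neq: False
      then show ?thesis
        using Cons.prems False by (intro exI[of _ "x # z # p"]) auto
    qed
  qed
qed simp

lemma induced_path_if_reachable:
  assumes "(x, y) \<in> rtrancl_on S (arcs_ends G)" "S \<subseteq> verts G"
  shows "\<exists>q. induced_path q \<and> q \<noteq> [] \<and> hd q = x \<and> last q = y \<and> set q \<subseteq> S"
  using assms(1)
proof (induction rule: converse_rtrancl_on_induct)
  case base
  then show ?case
    using assms(2) by (intro exI[of _ "[y]"]) auto
next
  case (step x z)
  then obtain p where p: "induced_path p" "p \<noteq> []" "hd p = z" "last p = y" "set p \<subseteq> S"
    by blast
  obtain q where "induced_path q" "q \<noteq> []" "hd q = x" "last q = last p" "set q \<subseteq> insert x (set p)"
    using induced_path_extend[of p x z] p step(1,3) assms(2) hd_in_set by blast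
  then show ?case
    using p(4,5) step(3) by (intro exI[of _ q]) auto
qed

section \<open>An induced path whose closed neighbourhood covers the bramble\<close>

text \<open>
  A walk in \<open>U\<close> from \<open>v\<close> to a vertex outside \<open>N[v]\<close> leaves \<open>N[v]\<close> for good after some neighbour
  \<open>w\<close> of \<open>v\<close>; its remaining part avoids \<open>N[v]\<close> except at \<open>w\<close>.  This neighbour is the next vertex
  of the growing path.
\<close>
lemma reachable_avoiding_neighbourhood:
  assumes reach: "(v, b) \<in> rtrancl_on U (arcs_ends G)" and b: "b \<notin> closed_neighbourhood G {v}"
  shows "\<exists>w\<in>U. v \<rightarrow>\<^bsub>G\<^esub> w \<and>
    (w, b) \<in> rtrancl_on (insert w (U - closed_neighbourhood G {v})) (arcs_ends G)"
proof -
  let ?N = "closed_neighbourhood G {v}"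
  let ?R = "\<lambda>w. (w, b) \<in> rtrancl_on (insert w (U - ?N)) (arcs_ends G)"
  \<comment> \<open>Induction along the walk needs an arbitrary start: either \<open>N[v]\<close> is never visited, or \<open>w\<close>
    has been found. For the start \<open>v \<in> N[v]\<close> the first case is impossible.\<close>
  have "(a, b) \<in> rtrancl_on (U - ?N) (arcs_ends G) \<or> (\<exists>w\<in>U. v \<rightarrow>\<^bsub>G\<^esub> w \<and> ?R w)"
    if "(a, b) \<in> rtrancl_on U (arcs_ends G)" for a
    using that
  proof (induction rule: converse_rtrancl_on_induct)
    case base
    then show ?case
      using b by auto
  next
    case (step x y)
    show ?case
    proof (cases "\<exists>w\<in>U. v \<rightarrow>\<^bsub>G\<^esub> w \<and> ?R w")
      case False
      then have y: "(y, b) \<in> rtrancl_on (U - ?N) (arcs_ends G)"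
        using step by blast
      then have "y \<notin> ?N"
        by (auto dest: in_rtrancl_on_in_F)
      then have "x \<noteq> v"
        using step(1) adj_in_verts by (auto simp: closed_neighbourhood_def adj_sym)
      have "(y, b) \<in> rtrancl_on (insert x (U - ?N)) (arcs_ends G)"
        using rtrancl_on_mono[OF subset_refl _ y] by auto
      then have R: "?R x"
        using step(1) by (auto intro: converse_rtrancl_on_into_rtrancl_on)
      with False step have "\<not> v \<rightarrow>\<^bsub>G\<^esub> x"
        by blast
      then have "x \<notin> ?N"
        using \<open>x \<noteq> v\<close> by (auto simp: closed_neighbourhood_def adj_sym)
      then show ?thesis
        using R step by (simp add: insert_absorb)
    qed blast
  qed
  from this[OF reach] show ?thesis
    by (auto dest!: in_rtrancl_on_in_F(1) simp: closed_neighbourhood_def)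
qed

text \<open>
  The growing path is \<open>v # q\<close>.  Its invariant is that some element \<open>B\<close> of the bramble avoids
  \<open>N[q]\<close> and can be reached from \<open>v\<close> without meeting \<open>N[q]\<close> again.  If another element \<open>B'\<close>
  avoids even \<open>N[v # q]\<close>, then \<open>B'\<close> can be reached through \<open>B\<close>, since \<open>B\<close> is connected and
  intersects \<open>B'\<close>.  The last neighbour \<open>w\<close> of \<open>v\<close> on the way is then a new head.  It lies
  outside \<open>N[q]\<close>, so \<open>w # v # q\<close> is again induced.  As the vertices of the path are distinct,
  this stops.
\<close>
lemma covering_induced_path_step:
  assumes bramble: "strong_bramble G \<B>"
    and "induced_path (v # q)"
    and "B \<in> \<B>" "B \<inter> closed_neighbourhood G (set q) = {}" "b \<in> B"
    and "(v, b) \<in> rtrancl_on (insert v (verts G - closed_neighbourhood G (set q))) (arcs_ends G)"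
  shows "\<exists>p. induced_path p \<and> (\<forall>B\<in>\<B>. closed_neighbourhood G (set p) \<inter> B \<noteq> {})"
  using assms(2-)
proof (induction "card (verts G) - length q" arbitrary: v q B b rule: less_induct)
  case less
  let ?N = "closed_neighbourhood G"
  let ?U = "insert v (verts G - ?N (set q))"
  show ?case
  proof (cases "\<forall>B\<in>\<B>. ?N (set (v # q)) \<inter> B \<noteq> {}")
    case True
    then show ?thesis
      using less.prems by blast
  next
    case False
    then obtain B' where B': "B' \<in> \<B>" "B' \<inter> ?N (set (v # q)) = {}"
      by blast
    have N: "?N (set (v # q)) = ?N {v} \<union> ?N (set q)"
      using closed_neighbourhood_Un[of G "{v}" "set q"] by simp
    obtain b' where b': "b' \<in> B" "b' \<in> B'"
      using bramble less.prems(2) B'(1) by (fastforce simp: strong_bramble_def)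
    have "B \<subseteq> ?U" "connected (G \<restriction> B)"
      using bramble less.prems by (auto simp: strong_bramble_def)
    then have "(b, b') \<in> rtrancl_on ?U (arcs_ends G)"
      using rtrancl_on_mono[OF subset_refl \<open>B \<subseteq> ?U\<close> connected_induce_subgraphD] less.prems b'
      by blast
    with less.prems(5) have "(v, b') \<in> rtrancl_on ?U (arcs_ends G)"
      by (rule rtrancl_on_trans)
    moreover have "b' \<notin> ?N {v}"
      using b' B' N by auto
    ultimately obtain w where w: "w \<in> ?U" "v \<rightarrow>\<^bsub>G\<^esub> w"
      "(w, b') \<in> rtrancl_on (insert w (?U - ?N {v})) (arcs_ends G)"
      using reachable_avoiding_neighbourhood by blast
    have "w \<noteq> v"
      using w adj_not_same by auto
    then have wN: "w \<in> verts G" "w \<notin> ?N (set q)"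
      using w by auto
    have path: "induced_path (w # v # q)"
      using less.prems(1) wN w(2) \<open>w \<noteq> v\<close>
      by (auto simp: closed_neighbourhood_def adj_sym)
    have "insert w (?U - ?N {v}) \<subseteq> insert w (verts G - ?N (set (v # q)))"
      unfolding N by (auto simp: closed_neighbourhood_def)
    then have reach: "(w, b') \<in> rtrancl_on (insert w (verts G - ?N (set (v # q)))) (arcs_ends G)"
      using rtrancl_on_mono[OF subset_refl _ w(3)] by blast
    have "length (w # v # q) \<le> card (verts G)"
      using card_mono[OF finite_verts induced_path_verts[OF path]]
        distinct_card[OF induced_path_distinct[OF path]] by simp
    then have "card (verts G) - length (v # q) < card (verts G) - length q"
      by simp
    from less.hyps[OF this path B' b'(2) reach] show ?thesis .
  qed
qed

lemma ex_covering_induced_path: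
  assumes "strong_bramble G \<B>"
  shows "\<exists>p. induced_path p \<and> (\<forall>B\<in>\<B>. closed_neighbourhood G (set p) \<inter> B \<noteq> {})"
proof (cases "\<B> = {}")
  case True
  then show ?thesis
    by (intro exI[of _ "[]"]) simp
next
  case False
  then obtain B v where B: "B \<in> \<B>" "v \<in> B"
    using assms by (fastforce simp: strong_bramble_def)
  then have "v \<in> verts G"
    using assms by (auto simp: strong_bramble_def)
  then show ?thesis
    using covering_induced_path_step[OF assms, of v "[]" B v] B
    by (auto simp: closed_neighbourhood_def)
qed

section \<open>Closing an induced path to an induced cycle\<close>

lemma cycle_graph_induce_subgraphI:
  assumes c: "distinct c" "set c \<subseteq> verts G" "3 \<le> length c"
    and adj: "\<And>i j. i < j \<Longrightarrow> j < length c \<Longrightarrow>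
      c ! i \<rightarrow>\<^bsub>G\<^esub> c ! j \<longleftrightarrow> j = Suc i \<or> i = 0 \<and> Suc j = length c"
  shows "cycle_graph (length c) (G \<restriction> set c)"
proof -
  let ?n = "length c"
  have cyc: "c ! i \<rightarrow>\<^bsub>G\<^esub> c ! j \<longleftrightarrow> j = Suc i mod ?n \<or> i = Suc j mod ?n" if "i < ?n" "j < ?n" for i j
  proof -
    have less: "c ! i \<rightarrow>\<^bsub>G\<^esub> c ! j \<longleftrightarrow> j = Suc i mod ?n \<or> i = Suc j mod ?n" if "i < j" "j < ?n" for i j
      using adj[OF that] that c(3) by (auto simp: mod_Suc)
    consider "i < j" | "j < i" | "i = j"
      by linarith
    then show ?thesis
    proof cases
      case 2
      then show ?thesis
        using less[of j i] that adj_sym by blast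
    next
      case 3
      then show ?thesis
        using that c(3) adj_not_same by (auto simp: mod_Suc)
    qed (use less that in blast)
  qed
  have "bij_betw ((!) c) {..<?n} (verts (G \<restriction> set c))"
    using c(1) by (simp add: bij_betw_nth)
  moreover have "arcs_ends (G \<restriction> set c) =
      {(c ! i, c ! j) | i j. i < ?n \<and> j < ?n \<and> (j = Suc i mod ?n \<or> i = Suc j mod ?n)}"
  proof (intro set_eqI iffI)
    fix e
    assume "e \<in> arcs_ends (G \<restriction> set c)"
    then obtain i j where "i < ?n" "j < ?n" "e = (c ! i, c ! j)" "c ! i \<rightarrow>\<^bsub>G\<^esub> c ! j"
      by (auto simp: arcs_ends_induce_subgraph in_set_conv_nth)
    then show "e \<in> {(c ! i, c ! j) | i j. i < ?n \<and> j < ?n \<and> (j = Suc i mod ?n \<or> i = Suc j mod ?n)}"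
      using cyc by blast
  next
    fix e
    assume "e \<in> {(c ! i, c ! j) | i j. i < ?n \<and> j < ?n \<and> (j = Suc i mod ?n \<or> i = Suc j mod ?n)}"
    then obtain i j where "i < ?n" "j < ?n" "e = (c ! i, c ! j)" "j = Suc i mod ?n \<or> i = Suc j mod ?n"
      by blast
    then show "e \<in> arcs_ends (G \<restriction> set c)"
      using cyc by (auto simp: arcs_ends_induce_subgraph)
  qed
  ultimately show ?thesis
    using graph_induce_subgraph[OF c(2)] c(3) unfolding cycle_graph_def by blast
qed

text \<open>
  The second path \<open>last p # r @ [hd p]\<close> returns from the end of \<open>p\<close> to its beginning, so that
  \<open>p @ r\<close> lists the cycle in order.  A chord within \<open>p\<close> or within \<open>r\<close>, or from \<open>r\<close> to an end of \<open>p\<close>,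
  would be a chord of one of the two induced paths; a chord from \<open>r\<close> to an inner vertex of \<open>p\<close> is
  excluded by \<open>sep\<close>.
\<close>
lemma cycle_graph_of_two_induced_paths:
  assumes p: "induced_path p" "3 \<le> length p" and q: "induced_path (last p # r @ [hd p])"
    and sep: "\<And>u x. u \<in> set r \<Longrightarrow> x \<in> set p \<Longrightarrow> u \<noteq> x \<and> (u \<rightarrow>\<^bsub>G\<^esub> x \<longrightarrow> x = hd p \<or> x = last p)"
  shows "cycle_graph (length p + length r) (G \<restriction> (set p \<union> set r))"
proof -
  let ?m = "length p" and ?l = "length r" and ?q = "last p # r @ [hd p]" and ?c = "p @ r"
  have ends: "hd p = p ! 0" "last p = p ! (?m - 1)"
    using p(2) hd_conv_nth[of p] last_conv_nth[of p] by fastforce+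
  have dist: "distinct p" "distinct ?q"
    using induced_path_distinct[OF p(1)] induced_path_distinct[OF q] .
  \<comment> \<open>As \<open>p\<close> has at least three vertices, its ends are not adjacent.\<close>
  have "r \<noteq> []"
  proof
    assume "r = []"
    then have "last p \<rightarrow>\<^bsub>G\<^esub> hd p"
      using q by simp
    then have "p ! 0 \<rightarrow>\<^bsub>G\<^esub> p ! (?m - 1)"
      using adj_sym ends by auto
    moreover have "0 < ?m - 1" "?m - 1 < ?m" "?m - 1 \<noteq> Suc 0"
      using p(2) by linarith+
    ultimately show False
      using induced_path_nth[OF p(1)] by blast
  qed
  then have l: "0 < ?l"
    by simp
  have q_nth: "?q ! 0 = last p" "?q ! Suc ?l = hd p" "\<And>j. j < ?l \<Longrightarrow> ?q ! Suc j = r ! j"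
    by (auto simp: nth_append)
  have adj: "?c ! i \<rightarrow>\<^bsub>G\<^esub> ?c ! j \<longleftrightarrow> j = Suc i \<or> i = 0 \<and> Suc j = length ?c"
    if ij: "i < j" "j < length ?c" for i j
  proof -
    consider "j < ?m" | "i < ?m" "?m \<le> j" | "?m \<le> i"
      by linarith
    then show ?thesis
    proof cases
      case 1
      then have "Suc j \<noteq> length ?c"
        using l by (simp only: length_append)
      then show ?thesis
        using induced_path_nth[OF p(1) ij(1)] ij 1 by (simp add: nth_append)
    next
      case 2
      define t where "t = j - ?m"
      have t: "j = ?m + t" "t < ?l" "?c ! i = p ! i" "?c ! j = r ! t"
        using 2 ij by (auto simp: t_def nth_append)
      consider "i = 0" | "i = ?m - 1" "i \<noteq> 0" | "i \<noteq> 0" "i \<noteq> ?m - 1"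
        by blast
      then show ?thesis
      proof cases
        case 1
        then have "?c ! i \<rightarrow>\<^bsub>G\<^esub> ?c ! j \<longleftrightarrow> ?q ! Suc t \<rightarrow>\<^bsub>G\<^esub> ?q ! Suc ?l"
          unfolding q_nth(2) q_nth(3)[OF t(2)] using t ends adj_sym by auto
        also have "\<dots> \<longleftrightarrow> Suc ?l = Suc (Suc t)"
          using t by (intro induced_path_nth[OF q]) auto
        finally show ?thesis
          using 1 t p(2) by auto
      next
        case i: 2
        then have "?c ! i \<rightarrow>\<^bsub>G\<^esub> ?c ! j \<longleftrightarrow> ?q ! 0 \<rightarrow>\<^bsub>G\<^esub> ?q ! Suc t"
          unfolding q_nth(1) q_nth(3)[OF t(2)] using t ends by auto
        also have "\<dots> \<longleftrightarrow> Suc t = Suc 0"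
          using t by (intro induced_path_nth[OF q]) auto
        finally show ?thesis
          using i t p(2) by auto
      next
        case i: 3
        have "0 < ?m" "?m - 1 < ?m"
          using p(2) by linarith+
        then have "p ! i \<noteq> hd p" "p ! i \<noteq> last p"
          unfolding ends using i 2(1) nth_eq_iff_index_eq[OF dist(1)] by blast+
        then have "\<not> r ! t \<rightarrow>\<^bsub>G\<^esub> p ! i"
          using sep[of "r ! t" "p ! i"] t 2 by auto
        then show ?thesis
          using t i 2 adj_sym by auto
      qed
    next
      case 3
      define s t where "s = i - ?m" and "t = j - ?m"
      have st: "i = ?m + s" "j = ?m + t" "s < t" "t < ?l"
        using 3 ij by (auto simp: s_def t_def)
      then have "?c ! i \<rightarrow>\<^bsub>G\<^esub> ?c ! j \<longleftrightarrow> ?q ! Suc s \<rightarrow>\<^bsub>G\<^esub> ?q ! Suc t"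
        using q_nth(3)[of s] q_nth(3)[of t] by (simp add: nth_append)
      also have "\<dots> \<longleftrightarrow> Suc t = Suc (Suc s)"
        using st by (intro induced_path_nth[OF q]) auto
      finally show ?thesis
        using st p(2) by auto
    qed
  qed
  have "distinct ?c"
    using dist sep by auto
  moreover have "set ?c \<subseteq> verts G"
    using induced_path_verts[OF p(1)] induced_path_verts[OF q] by auto
  ultimately have "cycle_graph (length ?c) (G \<restriction> set ?c)"
    using p(2) adj by (intro cycle_graph_induce_subgraphI) auto
  then show ?thesis
    by simp
qed

text \<open>
  Every vertex of \<open>B1\<close> is outside \<open>N[tl p]\<close>, so its only possible neighbour on \<open>p\<close> is \<open>hd p\<close>;
  symmetrically for \<open>B2\<close> and \<open>last p\<close>.  Hence any induced path from \<open>last p\<close> to \<open>hd p\<close>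
  through \<open>B1 \<union> B2\<close> closes \<open>p\<close> to an induced cycle.  Such a path exists because \<open>p\<close> is covering:
  \<open>B1\<close> contains \<open>hd p\<close> or a neighbour of it, \<open>B2\<close> contains \<open>last p\<close> or a neighbour of it,
  and \<open>B1 \<inter> B2\<close> is not empty.
\<close>
lemma induced_cycle_of_minimal_covering_path:
  assumes bramble: "strong_bramble G \<B>"
    and p: "induced_path p" "3 \<le> length p"
    and B1: "B1 \<in> \<B>" "closed_neighbourhood G (set (tl p)) \<inter> B1 = {}"
    and B2: "B2 \<in> \<B>" "closed_neighbourhood G (set (butlast p)) \<inter> B2 = {}"
    and cover: "\<And>B. B \<in> \<B> \<Longrightarrow> closed_neighbourhood G (set p) \<inter> B \<noteq> {}"
  shows "\<exists>r. cycle_graph (length p + length r) (G \<restriction> (set p \<union> set r)) \<and> set r \<subseteq> verts G"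
proof -
  let ?N = "closed_neighbourhood G" and ?x = "hd p" and ?y = "last p"
  let ?S = "insert ?x (insert ?y (B1 \<union> B2))"
  let ?R = "rtrancl_on ?S (arcs_ends G)"
  have ne: "p \<noteq> []"
    using p(2) by auto
  have "set p = set (?x # tl p)" "set p = set (butlast p @ [?y])"
    using ne by simp_all
  then have set_p: "set p = insert ?x (set (tl p))" "set p = insert ?y (set (butlast p))"
    by simp_all
  have verts: "?S \<subseteq> verts G" "set p \<subseteq> verts G"
    using induced_path_verts[OF p(1)] bramble B1(1) B2(1) ne
    by (auto simp: strong_bramble_def)
  have "?x \<noteq> ?y"
    using induced_path_distinct[OF p(1)] p(2) by (cases p) auto
  obtain b where b: "b \<in> B1" "b \<in> B2"
    using bramble B1(1) B2(1) by (fastforce simp: strong_bramble_def)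
  have to_end: "(z, b) \<in> ?R \<and> (b, z) \<in> ?R"
    if z: "z = ?x \<and> B = B1 \<or> z = ?y \<and> B = B2" and u: "u \<in> B" "u \<in> ?N {z}" for z B u
  proof -
    have "connected (G \<restriction> B)" "b \<in> B" "B \<subseteq> ?S" "z \<in> ?S"
      using z bramble B1(1) B2(1) b by (auto simp: strong_bramble_def)
    then have ub: "(u, b) \<in> ?R" "(b, u) \<in> ?R"
      using rtrancl_on_mono[OF subset_refl \<open>B \<subseteq> ?S\<close> connected_induce_subgraphD] u(1) by blast+
    show ?thesis
    proof (cases "u = z")
      case False
      then have "u \<rightarrow>\<^bsub>G\<^esub> z" "z \<rightarrow>\<^bsub>G\<^esub> u"
        using u(2) adj_sym by (auto simp: closed_neighbourhood_def)
      then show ?thesis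
        using ub \<open>z \<in> ?S\<close>
        by (meson converse_rtrancl_on_into_rtrancl_on rtrancl_on_into_rtrancl_on)
    qed (use ub in simp)
  qed
  obtain u1 where "u1 \<in> B1" "u1 \<in> ?N {?x}"
    using cover[OF B1(1)] B1(2) closed_neighbourhood_Un[of G "{?x}" "set (tl p)"] set_p(1) by auto
  then have "(b, ?x) \<in> ?R"
    using to_end by blast
  moreover obtain u2 where "u2 \<in> B2" "u2 \<in> ?N {?y}"
    using cover[OF B2(1)] B2(2) closed_neighbourhood_Un[of G "{?y}" "set (butlast p)"] set_p(2)
    by auto
  then have "(?y, b) \<in> ?R"
    using to_end by blast
  ultimately have "(?y, ?x) \<in> ?R"
    by (blast intro: rtrancl_on_trans)
  then obtain q where q: "induced_path q" "q \<noteq> []" "hd q = ?y" "last q = ?x" "set q \<subseteq> ?S"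
    using induced_path_if_reachable verts(1) by blast
  define r where "r = butlast (tl q)"
  have q_eq: "q = ?y # r @ [?x]"
  proof (cases q)
    case (Cons a q')
    then show ?thesis
      using q(3,4) \<open>?x \<noteq> ?y\<close> append_butlast_last_id[of q']
      by (cases "q' = []") (simp_all add: r_def)
  qed (use q in simp)
  have sep: "u \<noteq> z \<and> (u \<rightarrow>\<^bsub>G\<^esub> z \<longrightarrow> z = ?x \<or> z = ?y)" if u: "u \<in> set r" and z: "z \<in> set p" for u z
  proof -
    have "u \<in> ?S" "u \<noteq> ?x" "u \<noteq> ?y"
      using u q(5) induced_path_distinct[OF q(1)] unfolding q_eq by auto
    then have "u \<in> verts G" "u \<in> B1 \<or> u \<in> B2"
      using verts(1) by blast+
    then have "u \<notin> ?N (set (tl p)) \<or> u \<notin> ?N (set (butlast p))"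
      using B1(2) B2(2) by blast
    then show ?thesis
    proof
      assume "u \<notin> ?N (set (tl p))"
      moreover have "z = ?x \<or> z \<in> set (tl p)"
        using z set_p(1) by blast
      ultimately show ?thesis
        using \<open>u \<in> verts G\<close> \<open>u \<noteq> ?x\<close> unfolding closed_neighbourhood_def by blast
    next
      assume "u \<notin> ?N (set (butlast p))"
      moreover have "z = ?y \<or> z \<in> set (butlast p)"
        using z set_p(2) by blast
      ultimately show ?thesis
        using \<open>u \<in> verts G\<close> \<open>u \<noteq> ?y\<close> unfolding closed_neighbourhood_def by blast
    qed
  qed
  have "set r \<subseteq> verts G"
    using q(5) verts(1) unfolding q_eq by auto
  then show ?thesis
    using cycle_graph_of_two_induced_paths[OF p q(1)[unfolded q_eq] sep] by blast
qed

end

section \<open>The induced cycle\<close>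

theorem theorem1p5:
  fixes G :: "('a, 'b) pre_digraph" and \<B> :: "'a set set" and d k :: nat
  assumes "d \<ge> 1" and "k \<ge> 2"
    and "graph G"
    and "star_free d G"
    and "strong_bramble G \<B>"
    and "alpha_order G \<B> \<ge> d * k"
  shows "\<exists>C n. induced_subgraph C G \<and> cycle_graph n C \<and> n \<ge> k \<and>
           (\<forall>B\<in>\<B>. closed_neighbourhood G (verts C) \<inter> B \<noteq> {})"
proof -
  interpret graph G
    by fact
  let ?N = "closed_neighbourhood G"
  define covering where "covering p \<longleftrightarrow> induced_path p \<and> (\<forall>B\<in>\<B>. ?N (set p) \<inter> B \<noteq> {})" for p
  obtain p where "covering p" and shortest: "\<And>q. covering q \<Longrightarrow> length p \<le> length q"
    using ex_covering_induced_path[OF assms(5)] ex_has_least_nat[of covering _ length]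
    unfolding covering_def[symmetric] by metis
  then have path: "induced_path p" and cover: "\<And>B. B \<in> \<B> \<Longrightarrow> ?N (set p) \<inter> B \<noteq> {}"
    by (simp_all add: covering_def)
  have verts: "set p \<subseteq> verts G"
    using path by (rule induced_path_verts)
  have "bramble_cover G \<B> (?N (set p))"
    using cover verts by (auto simp: bramble_cover_def closed_neighbourhood_def)
  then have "d * k \<le> alpha G (?N (set p))"
    using assms(6) alpha_order_le le_trans by blast
  also have "\<dots> \<le> length p * max 1 (d - 1)"
    using alpha_closed_neighbourhood_le[OF assms(4) verts] .
  finally have count: "d * k \<le> length p * max 1 (d - 1)" .
  \<comment> \<open>For \<open>d = 1\<close> the graph has no edges, so a path with two vertices is absurd. For \<open>d \<ge> 2\<close>
    the factor \<open>d - 1\<close> instead of \<open>d\<close> makes the bound on the length strict, which gives three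
    vertices also for \<open>k = 2\<close>.\<close>
  have long: "k \<le> length p \<and> 3 \<le> length p"
  proof (cases "d = 1")
    case True
    then have k: "k \<le> length p"
      using count by simp
    then have 2: "0 < length p" "1 < length p"
      using assms(2) by auto
    then have "p ! 0 \<rightarrow>\<^bsub>G\<^esub> p ! 1"
      using induced_path_nth[OF path, of 0 1] by simp
    moreover have "p ! 0 \<in> verts G" "p ! 1 \<in> verts G"
      using nth_mem[OF 2(1)] nth_mem[OF 2(2)] verts by blast+
    ultimately have "card {p ! 1} < d"
      using adj_not_same
      by (intro card_independent_neighbours_less[OF assms(4), of "p ! 0"])
        (auto simp: independent_set_def)
    then show ?thesis
      using True by simp
  next
    case False
    then have "d * k \<le> length p * (d - 1)"
      using count assms(1) by (simp add: max_def split: if_splits)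
    moreover have "k * (d - 1) < d * k"
      using assms(1,2) by (simp add: mult.commute)
    ultimately have "k * (d - 1) < length p * (d - 1)"
      by linarith
    then have "k < length p"
      by simp
    then show ?thesis
      using assms(2) by linarith
  qed
  have "\<not> covering (tl p)" "\<not> covering (butlast p)"
    using shortest[of "tl p"] shortest[of "butlast p"] long by fastforce+
  then obtain B1 B2 where "B1 \<in> \<B>" "?N (set (tl p)) \<inter> B1 = {}"
    and "B2 \<in> \<B>" "?N (set (butlast p)) \<inter> B2 = {}"
    using induced_path_tl[OF path] induced_path_butlast[OF path] unfolding covering_def by blast
  then obtain r where r: "cycle_graph (length p + length r) (G \<restriction> (set p \<union> set r))"
    "set r \<subseteq> verts G"
    using induced_cycle_of_minimal_covering_path[OF assms(5) path] cover long by blast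
  have "\<forall>B\<in>\<B>. ?N (verts (G \<restriction> (set p \<union> set r))) \<inter> B \<noteq> {}"
    using cover closed_neighbourhood_mono[of "set p" "set p \<union> set r" G] by fastforce
  moreover have "induced_subgraph (G \<restriction> (set p \<union> set r)) G"
    using verts r(2) by (intro induced_induce) simp
  ultimately show ?thesis
    using r(1) long trans_le_add1 by blast
qed

end
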